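(* For any positive integer $m$, we have $$\zeta(2m+1) = \frac{8}{\pi^2}\,\frac{1}{2^{2m+1}-1}\sum_{k=1}^m \zeta_h(2k)\left(2^{2m-2k+2}-1\right)\zeta(2m-2k+2).$$
   Context: $\zeta$ denotes the Riemann zeta function. For $\Re s>1$, $\zeta_h(s) := \sum_{n=1}^\infty \frac{h_n}{n^s}$, where $h_n := \sum_{k=1}^n \frac{1}{2k-1}$ for each positive integer $n$. *)

theory Defs
  imports "HOL-Analysis.Analysis"
begin

text \<open>
  The Riemann zeta function on the half-plane \<open>Re s > 1\<close>, where it is given by its
  Dirichlet series. No analytic continuation is set up: for \<open>Re s \<le> 1\<close> the series does
  not converge and the value is meaningless. The index is shifted so that the sum runs
  over the positive integers.
\<close>

definition zeta :: "complex \<Rightarrow> complex" where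
  "zeta s = (\<Sum>n. 1 / of_nat (Suc n) powr s)"

definition odd_harm :: "nat \<Rightarrow> real" where
  "odd_harm n = (\<Sum>k=1..n. 1 / (2 * real k - 1))"

text \<open>As for \<open>zeta\<close>, the series is meant for \<open>Re s > 1\<close> only.\<close>

definition zeta_h :: "complex \<Rightarrow> complex" where
  "zeta_h s = (\<Sum>n. of_real (odd_harm (Suc n)) / of_nat (Suc n) powr s)"

end

theory Submission
  imports Defs "HOL-Real_Asymp.Real_Asymp"
begin

text \<open>
  Write \<open>a\<close> for the half-odd numbers \<open>1/2, 3/2, \<dots>\<close> and \<open>T s\<close> for the sum of all \<open>a ^ -s\<close>.
  Separating even and odd terms of \<open>2 ^ s * zeta s\<close> gives \<open>T s = (2 ^ s - 1) * zeta s\<close>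
  (\<open>half_odd_power_sums\<close>), so the claim is the convolution identity
  \<open>(\<Sum>k=1..m. zeta_h (2 k) * T (2 m - 2 k + 2)) = pi\<^sup>2 / 8 * T (2 m + 1)\<close>, which is
  \<open>odd_harm_zeta_convolution\<close>.

  Insert both series on the left. For a fixed positive integer \<open>n\<close> and a fixed \<open>a\<close> the sum over
  \<open>k\<close> is geometric and equals \<open>(n ^ (-2 m) - a ^ (-2 m)) / (a\<^sup>2 - n\<^sup>2)\<close>. Two partial fraction
  series then do all the work. The first is \<open>\<Sum>a. 1 / (a\<^sup>2 - n\<^sup>2) = 0\<close>
  (\<open>half_odd_square_diff_sums_0\<close>), the vanishing of \<open>tan (pi n)\<close>; it removes the term with
  \<open>n ^ (-2 m)\<close> and leaves the double sum of \<open>h n / (a ^ (2 m) * (n\<^sup>2 - a\<^sup>2))\<close>. This double sum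
  converges absolutely, so it may be summed over \<open>n\<close> first, and the second series
  \<open>\<Sum>n. h n / (n\<^sup>2 - a\<^sup>2) = pi\<^sup>2 / (8 a)\<close> (\<open>odd_harm_square_diff_sums\<close>) turns it into
  \<open>pi\<^sup>2 / 8 * T (2 m + 1)\<close>.

  The second series follows from the first. After splitting into partial fractions, passing from
  \<open>a\<close> to \<open>a + 1\<close> changes the sum by a series \<open>\<Sum>n. h n * (f n - f (n + 1))\<close>. Since
  \<open>h n - h (n - 1) = 1 / (2 n - 1)\<close>, summation by parts turns the change into
  \<open>\<Sum>n. f n / (2 n - 1)\<close>, which is again of the first kind and vanishes. At \<open>a = 1/2\<close> the same
  summation by parts gives \<open>T 2 / 2\<close>, with \<open>T 2 = pi\<^sup>2 / 2\<close> from Euler's evaluation of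
  \<open>zeta 2\<close>.
\<close>

abbreviation half_odd :: "nat \<Rightarrow> real" where
  "half_odd j \<equiv> real j + 1 / 2"

section \<open>Odd harmonic numbers\<close>

lemma odd_harm_0 [simp]: "odd_harm 0 = 0"
  by (simp add: odd_harm_def)

lemma odd_harm_Suc: "odd_harm (Suc n) = odd_harm n + 1 / (2 * real n + 1)"
  by (simp add: odd_harm_def)

lemma odd_harm_nonneg: "odd_harm n \<ge> 0"
  by (induction n) (auto simp: odd_harm_Suc)

text \<open>
  The growth is only logarithmic; a square root suffices for every convergence argument below and
  is preserved by the recursion because \<open>sqrt (n + 1) - sqrt n = 1 / (sqrt (n + 1) + sqrt n)\<close>
  is at least \<open>1 / (2 n + 1)\<close>.
\<close>

lemma odd_harm_le_sqrt: "odd_harm n \<le> sqrt (real n)"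
proof (induction n)
  case (Suc n)
  let ?p = "sqrt (real (Suc n))" and ?q = "sqrt (real n)"
  have sq: "?p * ?p = real n + 1" "?q * ?q = real n"
    by simp_all
  have "?p \<le> real n + 1"
    by (rule real_le_lsqrt) (auto simp: power2_eq_square algebra_simps)
  moreover have "?q \<le> real n"
    by (cases n) (auto intro!: real_le_lsqrt simp: power2_eq_square)
  ultimately have "?p + ?q \<le> 2 * real n + 1"
    by linarith
  have "0 < ?p + ?q"
    by (simp add: add_pos_nonneg)
  have "(?p - ?q) * (?p + ?q) = 1"
    using sq by (simp add: algebra_simps)
  hence "?p - ?q = 1 / (?p + ?q)"
    using \<open>0 < ?p + ?q\<close> by (simp add: field_simps)
  also have "\<dots> \<ge> 1 / (2 * real n + 1)"
    using \<open>0 < ?p + ?q\<close> \<open>?p + ?q \<le> 2 * real n + 1\<close> by (intro divide_left_mono) auto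
  finally show ?case
    using Suc by (simp add: odd_harm_Suc)
qed simp

lemma odd_harm_mult_tendsto_0:
  assumes "(\<lambda>n. sqrt (real n) * f n) \<longlonglongrightarrow> 0"
  shows "(\<lambda>n. odd_harm n * f n) \<longlonglongrightarrow> 0"
proof (rule Lim_null_comparison[OF _ tendsto_norm_zero[OF assms]])
  show "\<forall>\<^sub>F n in sequentially. norm (odd_harm n * f n) \<le> norm (sqrt (real n) * f n)"
    by (intro always_eventually allI)
       (auto simp: abs_mult odd_harm_nonneg odd_harm_le_sqrt intro!: mult_right_mono)
qed

text \<open>
  Summation by parts. The index is shifted by one, so that the boundary term is
  \<open>odd_harm n * f n\<close>: it vanishes at \<open>n = 0\<close> because \<open>odd_harm 0 = 0\<close>, and in the limit by
  the second assumption.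
\<close>

lemma sums_odd_harm_by_parts:
  fixes f :: "nat \<Rightarrow> real"
  assumes "(\<lambda>n. f n / (2 * real n + 1)) sums S"
    and "(\<lambda>n. sqrt (real n) * f n) \<longlonglongrightarrow> 0"
  shows "(\<lambda>n. odd_harm (Suc n) * (f n - f (Suc n))) sums S"
proof -
  have "(\<lambda>n. odd_harm n * f n - odd_harm (Suc n) * f (Suc n)) sums (odd_harm 0 * f 0 - 0)"
    by (rule telescope_sums'[OF odd_harm_mult_tendsto_0[OF assms(2)]])
  from sums_add[OF assms(1) this] show ?thesis
    by (simp add: odd_harm_Suc algebra_simps diff_divide_distrib)
qed

lemma summable_powr_3_2: "summable (\<lambda>n. real n powr (- (3/2)))"
  using summable_real_powr_iff[of "- (3/2)"] by simp

lemma summable_odd_harm_power: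
  assumes "s \<ge> 2"
  shows "summable (\<lambda>n. odd_harm (Suc n) / real (Suc n) ^ s)"
proof (rule summable_comparison_test'[where N = 0])
  show "summable (\<lambda>n. real (Suc n) powr (- (3/2)))"
    using summable_powr_3_2 by (subst summable_Suc_iff)
  fix n :: nat
  let ?x = "real (Suc n)"
  have "odd_harm (Suc n) / ?x ^ s \<le> sqrt ?x / ?x ^ 2"
    using assms by (intro frac_le odd_harm_le_sqrt power_increasing) (auto simp: odd_harm_nonneg)
  also have "\<dots> = ?x powr (1/2) / ?x powr 2"
    by (simp add: powr_half_sqrt)
  also have "\<dots> = ?x powr (- (3/2))"
    by (subst powr_diff [symmetric]) simp
  finally show "norm (odd_harm (Suc n) / ?x ^ s) \<le> ?x powr (- (3/2))"
    by (simp add: odd_harm_nonneg)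
qed

section \<open>Power sums over the half-odd numbers\<close>

text \<open>
  In the series of \<open>2 ^ s * z\<close> the terms with an odd base are \<open>(2 / (2 j + 1)) ^ s\<close>, the powers
  of the half-odd numbers, while the terms with an even base reproduce the series of \<open>z\<close>.
\<close>

lemma half_odd_power_sums:
  assumes "s \<ge> 2" and "(\<lambda>n. 1 / real (Suc n) ^ s) sums z"
  shows "(\<lambda>j. 1 / half_odd j ^ s) sums ((2 ^ s - 1) * z)"
proof -
  have "(\<lambda>n. \<Sum>i = n * 2..<n * 2 + 2. 2 ^ s * (1 / real (Suc i) ^ s)) sums (2 ^ s * z)"
    by (intro sums_group sums_mult assms) simp
  moreover have "(\<Sum>i = n * 2..<n * 2 + 2. 2 ^ s * (1 / real (Suc i) ^ s))
      = 1 / half_odd n ^ s + 1 / real (Suc n) ^ s" for n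
  proof -
    have "{n * 2..<n * 2 + 2} = {2 * n, 2 * n + 1}"
      by auto
    moreover have "2 ^ s * (1 / real (Suc (2 * n)) ^ s) = 1 / half_odd n ^ s"
    proof -
      have "real (Suc (2 * n)) = 2 * half_odd n"
        by simp
      thus ?thesis
        by (simp only: power_mult_distrib) simp
    qed
    moreover have "2 ^ s * (1 / real (Suc (2 * n + 1)) ^ s) = 1 / real (Suc n) ^ s"
    proof -
      have "real (Suc (2 * n + 1)) = 2 * real (Suc n)"
        by simp
      thus ?thesis
        by (simp only: power_mult_distrib) simp
    qed
    ultimately show ?thesis
      by simp
  qed
  ultimately have "(\<lambda>n. 1 / half_odd n ^ s + 1 / real (Suc n) ^ s) sums (2 ^ s * z)"
    by simp
  from sums_diff[OF this assms(2)] show ?thesis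
    by (simp add: algebra_simps)
qed

lemma half_odd_square_sums: "(\<lambda>j. 1 / half_odd j ^ 2) sums (pi ^ 2 / 2)"
proof -
  have "(\<lambda>n. 1 / real (Suc n) ^ 2) sums (pi ^ 2 / 6)"
    using inverse_squares_sums by (simp add: add.commute)
  from half_odd_power_sums[OF _ this] show ?thesis
    by simp
qed

lemma half_odd_neq_int: "half_odd j \<noteq> of_int i"
proof
  assume "half_odd j = of_int i"
  hence "real_of_int (2 * int j + 1) = of_int (2 * i)"
    by simp
  hence "2 * int j + 1 = 2 * i"
    by (simp only: of_int_eq_iff)
  thus False
    by presburger
qed

lemma half_odd_square_neq: "half_odd j ^ 2 \<noteq> real n ^ 2"
  using half_odd_neq_int[of j "int n"] half_odd_neq_int[of j "- int n"]
  by (auto simp: power2_eq_iff)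

section \<open>Two partial fraction evaluations\<close>

text \<open>
  Up to a factor \<open>pi\<close> the sum is the value at \<open>n\<close> of the partial fraction expansion of
  \<open>tan (pi x)\<close>. At integers a telescoping argument replaces the expansion: raising \<open>n\<close> by one
  adds the first terms \<open>1 / (-1/2 - n)\<close> and \<open>1 / (1/2 + n)\<close> of two telescoping series, and these
  cancel.
\<close>

lemma half_odd_partial_fraction_sums:
  "(\<lambda>j. 1 / (half_odd j - real n) - 1 / (half_odd j + real n)) sums 0"
proof (induction n)
  case 0
  show ?case by simp
next
  case (Suc n)
  let ?L = "\<lambda>j. 1 / (half_odd j - real (Suc n))" and ?R = "\<lambda>j. 1 / (half_odd j + real n)"
  have "?L \<longlonglongrightarrow> 0" "?R \<longlonglongrightarrow> 0"
    by real_asymp+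
  hence "(\<lambda>j. (?L j - ?L (Suc j)) + (?R j - ?R (Suc j))) sums ((?L 0 - 0) + (?R 0 - 0))"
    by (intro sums_add telescope_sums')
  moreover have "(?L 0 - 0) + (?R 0 - 0) = 0"
    by (simp add: field_simps)
  ultimately have "(\<lambda>j. (?L j - ?L (Suc j)) + (?R j - ?R (Suc j))) sums 0"
    by simp
  from sums_add[OF Suc this] show ?case
    by (simp add: algebra_simps)
qed

lemma half_odd_square_diff_sums_0:
  assumes "n \<ge> 1"
  shows "(\<lambda>j. 1 / (half_odd j ^ 2 - real n ^ 2)) sums 0"
proof -
  have "1 / (2 * real n) * (1 / (half_odd j - real n) - 1 / (half_odd j + real n))
      = 1 / (half_odd j ^ 2 - real n ^ 2)" for j
  proof -
    have eq: "half_odd j ^ 2 - real n ^ 2 = (half_odd j - real n) * (half_odd j + real n)"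
      by (simp add: power2_eq_square algebra_simps)
    have "half_odd j - real n \<noteq> 0" "half_odd j + real n \<noteq> 0"
      using half_odd_neq_int[of j "int n"] half_odd_neq_int[of j "- int n"] by auto
    moreover have "1 / (2 * c) * (1 / (x - c) - 1 / (x + c)) = 1 / ((x - c) * (x + c))"
      if "x - c \<noteq> 0" "x + c \<noteq> 0" "c \<noteq> 0" for x c :: real
      using that by (simp add: divide_simps)
    ultimately show ?thesis
      using assms unfolding eq by simp
  qed
  with sums_mult[OF half_odd_partial_fraction_sums[of n], of "1 / (2 * real n)"]
  show ?thesis
    by simp
qed

text \<open>
  The value does not depend on \<open>j\<close>. With \<open>c = j + 1\<close>, the change from \<open>j\<close> to \<open>j + 1\<close> is
  the series of \<open>odd_harm (n + 1) * (f n - f (n + 1))\<close> for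
  \<open>f n = 1 / (n + 1/2 - c) + 1 / (n + 1/2 + c)\<close>. Dividing \<open>f n\<close> by \<open>2 n + 1\<close> cancels its
  numerator, so summation by parts leaves \<open>1 / ((n + 1/2)\<^sup>2 - c\<^sup>2)\<close>, whose sum is zero.
  For \<open>j = 0\<close> the role of \<open>f\<close> is played by \<open>1 / (n + 1/2)\<close>.
\<close>

lemma odd_harm_partial_fraction_sums:
  "(\<lambda>n. odd_harm (Suc n) * (1 / (real (Suc n) - half_odd j) - 1 / (real (Suc n) + half_odd j)))
     sums (pi ^ 2 / 4)"
proof (induction j)
  case 0
  let ?f = "\<lambda>n. 1 / half_odd n"
  have "?f n / (2 * real n + 1) = 1 / half_odd n ^ 2 / 2" for n
  proof -
    have "2 * real n + 1 = half_odd n * 2"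
      by simp
    thus ?thesis
      by (simp only: power2_eq_square divide_divide_eq_left mult.assoc)
  qed
  with sums_divide[OF half_odd_square_sums, of 2]
  have "(\<lambda>n. ?f n / (2 * real n + 1)) sums (pi ^ 2 / 4)"
    by simp
  moreover have "(\<lambda>n. sqrt (real n) * ?f n) \<longlonglongrightarrow> 0"
    by real_asymp
  ultimately show ?case
    using sums_odd_harm_by_parts[of ?f] by (simp add: algebra_simps)
next
  case (Suc j)
  let ?f = "\<lambda>n. 1 / (half_odd n - real (Suc j)) + 1 / (half_odd n + real (Suc j))"
  have "?f n / (2 * real n + 1) = 1 / (half_odd n ^ 2 - real (Suc j) ^ 2)" for n
  proof -
    have eq: "half_odd n ^ 2 - real (Suc j) ^ 2
        = (half_odd n - real (Suc j)) * (half_odd n + real (Suc j))"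
      by (simp add: power2_eq_square algebra_simps)
    have "half_odd n - real (Suc j) \<noteq> 0" "half_odd n + real (Suc j) \<noteq> 0" "half_odd n \<noteq> 0"
      using half_odd_neq_int[of n "int (Suc j)"] half_odd_neq_int[of n "- int (Suc j)"]
        half_odd_neq_int[of n 0] by auto
    moreover have "(1 / (x - c) + 1 / (x + c)) / (2 * x) = 1 / ((x - c) * (x + c))"
      if "x - c \<noteq> 0" "x + c \<noteq> 0" "x \<noteq> 0" for x c :: real
      using that by (simp add: divide_simps)
    moreover have "2 * real n + 1 = 2 * half_odd n"
      by simp
    ultimately show ?thesis
      unfolding eq by metis
  qed
  with half_odd_square_diff_sums_0[of "Suc j"]
  have "(\<lambda>n. ?f n / (2 * real n + 1)) sums 0"
    by simp
  moreover have "(\<lambda>n. sqrt (real n) * ?f n) \<longlonglongrightarrow> 0"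
    by real_asymp
  ultimately have "(\<lambda>n. odd_harm (Suc n) * (?f n - ?f (Suc n))) sums 0"
    by (rule sums_odd_harm_by_parts)
  from sums_add[OF Suc this] show ?case
    by (simp add: algebra_simps)
qed

lemma odd_harm_square_diff_sums:
  "(\<lambda>n. odd_harm (Suc n) / (real (Suc n) ^ 2 - half_odd j ^ 2)) sums (pi ^ 2 / 8 / half_odd j)"
proof -
  let ?a = "half_odd j"
  have "1 / (2 * ?a) * (odd_harm (Suc n) * (1 / (real (Suc n) - ?a) - 1 / (real (Suc n) + ?a)))
      = odd_harm (Suc n) / (real (Suc n) ^ 2 - ?a ^ 2)" for n
  proof -
    have eq: "real (Suc n) ^ 2 - ?a ^ 2 = (real (Suc n) - ?a) * (real (Suc n) + ?a)"
      by (simp add: power2_eq_square algebra_simps)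
    have "real (Suc n) - ?a \<noteq> 0" "real (Suc n) + ?a \<noteq> 0" "?a \<noteq> 0"
      using half_odd_neq_int[of j "int (Suc n)"] half_odd_neq_int[of j "- int (Suc n)"]
        half_odd_neq_int[of j 0] by auto
    moreover have "1 / (2 * c) * (h * (1 / (x - c) - 1 / (x + c))) = h / ((x - c) * (x + c))"
      if "x - c \<noteq> 0" "x + c \<noteq> 0" "c \<noteq> 0" for x c h :: real
      using that by (simp add: divide_simps)
    ultimately show ?thesis
      unfolding eq by metis
  qed
  with sums_mult[OF odd_harm_partial_fraction_sums[of j], of "1 / (2 * ?a)"]
  show ?thesis
    by (simp add: field_simps)
qed

section \<open>Interchanging the order of summation\<close>

text \<open>
  Fubini's theorem for an absolutely convergent double series whose row sums and column sums are
  known as ordinary series.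
\<close>

lemma sums_swap:
  fixes F :: "nat \<times> nat \<Rightarrow> real"
  assumes "F summable_on UNIV"
    and "\<And>n. (\<lambda>j. F (n, j)) sums g n"
    and "\<And>j. (\<lambda>n. F (n, j)) sums h j"
    and "g sums S"
  shows "h sums S"
proof -
  have sections: "(g has_sum infsum F UNIV) UNIV"
    if "F summable_on UNIV" "\<And>n. (\<lambda>j. F (n, j)) sums g n"
    for F :: "nat \<times> nat \<Rightarrow> real" and g
  proof (rule has_sum_SigmaD)
    show "(F has_sum infsum F UNIV) (Sigma UNIV (\<lambda>_. UNIV))"
      using that(1) by simp
    show "((\<lambda>j. F (n, j)) has_sum g n) UNIV" for n
    proof -
      have "(\<lambda>j. F (n, j)) summable_on UNIV"
        using summable_on_SigmaD1[of "\<lambda>n j. F (n, j)" UNIV "\<lambda>_. UNIV" n] that(1) by simp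
      then obtain x where x: "((\<lambda>j. F (n, j)) has_sum x) UNIV"
        by (auto simp: summable_on_def)
      with that(2)[of n] show ?thesis
        using has_sum_imp_sums sums_unique2 by blast
    qed
  qed
  have swapped: "((\<lambda>(j, n). F (n, j)) has_sum infsum F UNIV) UNIV"
    using assms(1) has_sum_swap[of F UNIV UNIV "infsum F UNIV"] by simp
  have "(g has_sum infsum F UNIV) UNIV"
    using sections[OF assms(1,2)] .
  moreover have "(h has_sum infsum F UNIV) UNIV"
    using sections[of "\<lambda>(j, n). F (n, j)" h] swapped assms(3)
    by (auto simp: infsumI summable_on_def)
  ultimately show ?thesis
    using assms(4) has_sum_imp_sums sums_unique2 by blast
qed

text \<open>
  A summable majorant that depends on the difference of the two summation indices only:
  \<open>int_weight i\<close> is \<open>\<bar>i + 1/2\<bar> powr (-3/2)\<close>. Indexing it by the integers makes the bound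
  uniform in both indices.
\<close>

definition int_weight :: "int \<Rightarrow> real" where
  "int_weight i = 1 / (\<bar>of_int i + 1 / 2\<bar> * sqrt \<bar>of_int i + 1 / 2\<bar>)"

lemma summable_int_weight: "int_weight summable_on UNIV"
proof -
  have "summable (\<lambda>n. norm (int_weight (int n)))"
  proof (rule summable_comparison_test'[OF summable_powr_3_2, where N = 1])
    fix n :: nat
    assume "n \<ge> 1"
    hence "1 / (half_odd n * sqrt (half_odd n)) \<le> 1 / (real n * sqrt (real n))"
      by (intro divide_left_mono mult_mono) auto
    also have "\<dots> = 1 / (real n powr 1 * real n powr (1/2))"
      by (simp add: powr_half_sqrt)
    also have "\<dots> = real n powr (- (3/2))"
      by (subst powr_add [symmetric]) (simp add: powr_minus field_simps)
    finally show "norm (norm (int_weight (int n))) \<le> real n powr (- (3/2))"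
      by (simp add: int_weight_def)
  qed
  hence nat: "(\<lambda>n. int_weight (int n)) summable_on UNIV"
    by (rule norm_summable_imp_summable_on)
  have pos: "int_weight summable_on range int"
    using nat by (subst summable_on_reindex) (auto simp: o_def)
  \<comment> \<open>The reflection \<open>i \<mapsto> -i - 1\<close> about \<open>-1/2\<close> exchanges negative and nonnegative integers.\<close>
  have "int_weight (- int n - 1) = int_weight (int n)" for n
  proof -
    have "\<bar>real_of_int (- int n - 1) + 1 / 2\<bar> = \<bar>of_int (int n) + 1 / 2\<bar>"
      by simp
    thus ?thesis
      unfolding int_weight_def by metis
  qed
  hence neg: "int_weight summable_on range (\<lambda>n. - int n - 1)"
    using nat by (subst summable_on_reindex) (auto simp: o_def inj_on_def)
  have "i \<in> range int \<union> range (\<lambda>n. - int n - 1)" for i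
  proof (cases "i \<ge> 0")
    case True
    hence "i = int (nat i)" by simp
    thus ?thesis by blast
  next
    case False
    hence "i = - int (nat (- i - 1)) - 1" by simp
    thus ?thesis by blast
  qed
  hence "UNIV = range int \<union> range (\<lambda>n. - int n - 1)"
    by blast
  moreover have "range int \<inter> range (\<lambda>n. - int n - 1) = {}"
    by auto
  ultimately show ?thesis
    using summable_on_Un_disjoint[OF pos neg] by metis
qed

text \<open>
  Factor the denominator as \<open>s * d\<close> with the sum \<open>s = n + 1 + a\<close> and the distance
  \<open>d = \<bar>n + 1 - a\<bar>\<close>. The harmonic number is at most \<open>sqrt s\<close>, which leaves
  \<open>1 / (d * sqrt s)\<close>, and \<open>d \<le> s\<close>.
\<close>

lemma odd_harm_square_diff_bound:
  "\<bar>odd_harm (Suc n) / (real (Suc n) ^ 2 - half_odd j ^ 2)\<bar> \<le> int_weight (int n - int j)"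
proof -
  define s where "s = real (Suc n) + half_odd j"
  define d where "d = \<bar>real (Suc n) - half_odd j\<bar>"
  have "d \<noteq> 0"
    using half_odd_neq_int[of j "int (Suc n)"] by (auto simp: d_def)
  hence d: "d > 0" "d \<le> s"
    by (auto simp: d_def s_def)
  have sd: "s * d = \<bar>real (Suc n) ^ 2 - half_odd j ^ 2\<bar>"
  proof -
    have "real (Suc n) ^ 2 - half_odd j ^ 2 = s * (real (Suc n) - half_odd j)"
      by (simp add: s_def power2_eq_square algebra_simps)
    moreover have "\<bar>s\<bar> = s"
      by (simp add: s_def)
    ultimately show ?thesis
      by (simp add: abs_mult d_def)
  qed
  have "odd_harm (Suc n) \<le> sqrt s"
    by (rule order_trans[OF odd_harm_le_sqrt real_sqrt_le_mono]) (simp add: s_def)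
  hence "odd_harm (Suc n) / (s * d) \<le> sqrt s / (s * d)"
    using d by (intro divide_right_mono) auto
  also have "\<dots> = 1 / (d * sqrt s)"
  proof -
    have "s = sqrt s * sqrt s" "sqrt s > 0"
      using d by auto
    thus ?thesis
      using d(1) by (simp add: field_simps)
  qed
  also have "\<dots> \<le> 1 / (d * sqrt d)"
    using d by (intro divide_left_mono mult_left_mono) auto
  also have "\<dots> = int_weight (int n - int j)"
  proof -
    have "d = \<bar>real_of_int (int n - int j) + 1 / 2\<bar>"
      by (simp add: d_def algebra_simps)
    thus ?thesis
      by (simp add: int_weight_def)
  qed
  finally show ?thesis
    by (simp add: sd odd_harm_nonneg)
qed

text \<open>
  In the coordinates \<open>(j, n - j)\<close> the majorant is a product of \<open>half_odd j ^ (-2 m)\<close> and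
  \<open>int_weight (n - j)\<close>, hence summable over all pairs of a natural number and an integer. The pairs
  \<open>(n, j)\<close> embed injectively into these.
\<close>

lemma summable_on_odd_harm_kernel:
  assumes "m \<ge> 1"
  shows "(\<lambda>(n, j). odd_harm (Suc n) / (half_odd j ^ (2 * m) * (real (Suc n) ^ 2 - half_odd j ^ 2)))
           summable_on UNIV"
proof -
  let ?c = "\<lambda>j. 1 / half_odd j ^ (2 * m)"
  have "summable (\<lambda>n. 1 / real (Suc n) ^ (2 * m))"
    using inverse_power_summable[of "2 * m", where ?'a = real] assms
    by (subst summable_Suc_iff) (simp add: inverse_eq_divide)
  hence "summable ?c"
    using half_odd_power_sums[of "2 * m"] assms by (auto simp: summable_def)
  hence c: "?c summable_on UNIV"
    by (intro norm_summable_imp_summable_on) simp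
  have "(\<lambda>(j, i). ?c j * int_weight i) summable_on UNIV \<times> UNIV"
  proof (rule summable_on_SigmaI)
    show "((\<lambda>i. case (j, i) of (j, i) \<Rightarrow> ?c j * int_weight i)
            has_sum ?c j * infsum int_weight UNIV) UNIV" for j
      unfolding prod.case by (intro has_sum_cmult_right has_sum_infsum summable_int_weight)
    show "(\<lambda>j. ?c j * infsum int_weight UNIV) summable_on UNIV"
      by (intro summable_on_cmult_left c)
  qed (auto simp: int_weight_def)
  hence "(\<lambda>(j, i). ?c j * int_weight i) summable_on range (\<lambda>(n, j). (j, int n - int j))"
    by (rule summable_on_subset) auto
  hence "((\<lambda>(j, i). ?c j * int_weight i) \<circ> (\<lambda>(n, j). (j, int n - int j))) summable_on UNIV"
    by (subst (asm) summable_on_reindex) (auto simp: inj_on_def)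
  hence "(\<lambda>(n, j). ?c j * int_weight (int n - int j)) summable_on UNIV"
    by (simp add: o_def case_prod_unfold)
  hence "(\<lambda>x. norm ((\<lambda>(n, j). odd_harm (Suc n) /
           (half_odd j ^ (2 * m) * (real (Suc n) ^ 2 - half_odd j ^ 2))) x)) summable_on UNIV"
  proof (rule Infinite_Sum.abs_summable_on_comparison_test')
    fix x :: "nat \<times> nat"
    obtain n j where x: "x = (n, j)" by force
    have "\<bar>odd_harm (Suc n) / (half_odd j ^ (2 * m) * (real (Suc n) ^ 2 - half_odd j ^ 2))\<bar>
        = ?c j * \<bar>odd_harm (Suc n) / (real (Suc n) ^ 2 - half_odd j ^ 2)\<bar>"
      by (simp add: abs_mult)
    also have "\<dots> \<le> ?c j * int_weight (int n - int j)"
      by (intro mult_left_mono odd_harm_square_diff_bound) simp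
    finally show "norm (case x of (n, j) \<Rightarrow>
        odd_harm (Suc n) / (half_odd j ^ (2 * m) * (real (Suc n) ^ 2 - half_odd j ^ 2)))
      \<le> (case x of (n, j) \<Rightarrow> ?c j * int_weight (int n - int j))"
      by (simp add: x)
  qed
  thus ?thesis
    by (rule Infinite_Sum.abs_summable_summable)
qed

section \<open>The convolution identity\<close>

lemma sum_inverse_powers_convolution:
  fixes x y :: real
  assumes "x \<noteq> 0" "y \<noteq> 0" "x \<noteq> y"
  shows "(\<Sum>k=1..m. 1 / (x ^ k * y ^ (m + 1 - k))) = (1 / x ^ m - 1 / y ^ m) / (y - x)"
proof (induction m)
  case (Suc m)
  have "(\<Sum>k=1..Suc m. 1 / (x ^ k * y ^ (Suc m + 1 - k)))
      = (\<Sum>k=1..m. 1 / (x ^ k * y ^ (m + 1 - k))) / y + 1 / (x ^ Suc m * y)"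
    by (simp add: sum_divide_distrib Suc_diff_le mult_ac)
  also have "\<dots> = (1 / x ^ Suc m - 1 / y ^ Suc m) / (y - x)"
    unfolding Suc using assms by (simp add: divide_simps) (simp add: algebra_simps)
  finally show ?case .
qed simp

text \<open>
  Both sides are iterated sums of the kernel \<open>F\<close> below: the row sums over \<open>j\<close> add up to the left
  side, the column sums over \<open>n\<close> to the right side.
\<close>

lemma odd_harm_zeta_convolution:
  fixes T H :: "nat \<Rightarrow> real"
  assumes "m \<ge> 1"
    and T: "\<And>s. s \<ge> 2 \<Longrightarrow> (\<lambda>j. 1 / half_odd j ^ s) sums T s"
    and H: "\<And>s. s \<ge> 2 \<Longrightarrow> (\<lambda>n. odd_harm (Suc n) / real (Suc n) ^ s) sums H s"
  shows "(\<Sum>k=1..m. H (2 * k) * T (2 * m - 2 * k + 2)) = pi ^ 2 / 8 * T (2 * m + 1)"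
proof -
  define F where "F = (\<lambda>(n, j). odd_harm (Suc n) /
    (half_odd j ^ (2 * m) * (real (Suc n) ^ 2 - half_odd j ^ 2)))"
  define g where "g n = (\<Sum>k=1..m. odd_harm (Suc n) / real (Suc n) ^ (2 * k) * T (2 * m - 2 * k + 2))"
    for n
  have F_sums: "(\<lambda>j. F (n, j)) sums g n" for n
  proof -
    let ?h = "odd_harm (Suc n)" and ?N = "real (Suc n)"
    have "(\<lambda>j. \<Sum>k=1..m. ?h / ?N ^ (2 * k) * (1 / half_odd j ^ (2 * m - 2 * k + 2))) sums g n"
      unfolding g_def by (intro sums_sum sums_mult T) simp
    \<comment> \<open>The geometric sum differs from the kernel by a multiple of a series with sum zero.\<close>
    moreover have "(\<Sum>k=1..m. ?h / ?N ^ (2 * k) * (1 / half_odd j ^ (2 * m - 2 * k + 2)))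
        = ?h / ?N ^ (2 * m) * (1 / (half_odd j ^ 2 - ?N ^ 2)) + F (n, j)" for j
    proof -
      define x y where "x = ?N ^ 2" and "y = half_odd j ^ 2"
      have xy: "x \<noteq> 0" "y \<noteq> 0" "x \<noteq> y"
        using half_odd_square_neq[of j "Suc n"] half_odd_neq_int[of j 0]
        by (auto simp: x_def y_def simp del: of_nat_Suc)
      have "(\<Sum>k=1..m. ?h / ?N ^ (2 * k) * (1 / half_odd j ^ (2 * m - 2 * k + 2)))
          = ?h * (\<Sum>k=1..m. 1 / (x ^ k * y ^ (m + 1 - k)))"
        unfolding sum_distrib_left
      proof (rule sum.cong[OF refl])
        fix k assume "k \<in> {1..m}"
        hence "2 * m - 2 * k + 2 = 2 * (m + 1 - k)" by auto
        thus "?h / ?N ^ (2 * k) * (1 / half_odd j ^ (2 * m - 2 * k + 2))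
            = ?h * (1 / (x ^ k * y ^ (m + 1 - k)))"
          by (simp add: x_def y_def power_mult)
      qed
      also have "\<dots> = ?h * ((1 / x ^ m - 1 / y ^ m) / (y - x))"
        by (simp only: sum_inverse_powers_convolution[OF xy])
      also have "\<dots> = ?h / x ^ m * (1 / (y - x)) + ?h / (y ^ m * (x - y))"
        using xy by (simp add: divide_simps) (simp add: algebra_simps)
      finally show ?thesis
        by (simp add: F_def x_def y_def power_mult)
    qed
    ultimately have "(\<lambda>j. ?h / ?N ^ (2 * m) * (1 / (half_odd j ^ 2 - ?N ^ 2)) + F (n, j)) sums g n"
      by simp
    moreover have "(\<lambda>j. ?h / ?N ^ (2 * m) * (1 / (half_odd j ^ 2 - ?N ^ 2)))
        sums (?h / ?N ^ (2 * m) * 0)"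
      by (intro sums_mult half_odd_square_diff_sums_0) simp
    ultimately show ?thesis
      using sums_diff by fastforce
  qed
  have F_sums': "(\<lambda>n. F (n, j)) sums (pi ^ 2 / 8 * (1 / half_odd j ^ (2 * m + 1)))" for j
  proof -
    let ?p = "half_odd j ^ (2 * m)"
    have "F (n, j) = 1 / ?p * (odd_harm (Suc n) / (real (Suc n) ^ 2 - half_odd j ^ 2))" for n
      by (simp add: F_def)
    moreover have "pi ^ 2 / 8 * (1 / half_odd j ^ (2 * m + 1)) = 1 / ?p * (pi ^ 2 / 8 / half_odd j)"
      by simp
    ultimately show ?thesis
      using sums_mult[OF odd_harm_square_diff_sums[of j], of "1 / ?p"] by presburger
  qed
  have g_sums: "g sums (\<Sum>k=1..m. H (2 * k) * T (2 * m - 2 * k + 2))"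
    unfolding g_def by (intro sums_sum sums_mult2 H) simp
  have "F summable_on UNIV"
    unfolding F_def by (rule summable_on_odd_harm_kernel[OF assms(1)])
  from sums_swap[OF this F_sums F_sums' g_sums]
  have "(\<lambda>j. pi ^ 2 / 8 * (1 / half_odd j ^ (2 * m + 1)))
      sums (\<Sum>k=1..m. H (2 * k) * T (2 * m - 2 * k + 2))" .
  moreover have "(\<lambda>j. pi ^ 2 / 8 * (1 / half_odd j ^ (2 * m + 1))) sums (pi ^ 2 / 8 * T (2 * m + 1))"
    using assms(1) by (intro sums_mult T) simp
  ultimately show ?thesis
    by (rule sums_unique2)
qed

section \<open>Integer arguments of the complex Dirichlet series\<close>

lemma of_real_zeta_sums:
  assumes "s \<ge> 2"
  obtains z where "(\<lambda>n. 1 / real (Suc n) ^ s) sums z" and "zeta (of_nat s) = of_real z"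
proof -
  have "summable (\<lambda>n. 1 / real (Suc n) ^ s)"
    using inverse_power_summable[OF assms, where ?'a = real]
    by (subst summable_Suc_iff) (simp add: inverse_eq_divide)
  then obtain z where z: "(\<lambda>n. 1 / real (Suc n) ^ s) sums z"
    by (auto simp: summable_def)
  have "(1::complex) / of_nat (Suc n) powr of_nat s = of_real (1 / real (Suc n) ^ s)" for n
    by (simp add: powr_nat del: of_nat_Suc)
  hence "zeta (of_nat s) = of_real z"
    using sums_unique[OF sums_of_real[OF z, where ?'a = complex]]
    unfolding zeta_def by (simp only:)
  with z that show thesis by blast
qed

lemma of_real_zeta_h_sums:
  assumes "s \<ge> 2"
  obtains z where "(\<lambda>n. odd_harm (Suc n) / real (Suc n) ^ s) sums z"
    and "zeta_h (of_nat s) = of_real z"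
proof -
  obtain z where z: "(\<lambda>n. odd_harm (Suc n) / real (Suc n) ^ s) sums z"
    using summable_odd_harm_power[OF assms] by (auto simp: summable_def)
  have "of_real (odd_harm (Suc n)) / of_nat (Suc n) powr of_nat s
      = complex_of_real (odd_harm (Suc n) / real (Suc n) ^ s)" for n
    by (simp add: powr_nat del: of_nat_Suc)
  hence "zeta_h (of_nat s) = of_real z"
    using sums_unique[OF sums_of_real[OF z, where ?'a = complex]]
    unfolding zeta_h_def by (simp only:)
  with z that show thesis by blast
qed

theorem corollary2p6:
  fixes m :: nat
  assumes "m \<ge> 1"
  shows "zeta (of_nat (2 * m + 1)) =
    8 / of_real (pi ^ 2) * (1 / (2 ^ (2 * m + 1) - 1)) *
    (\<Sum>k=1..m. zeta_h (of_nat (2 * k)) * (2 ^ (2 * m - 2 * k + 2) - 1)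
       * zeta (of_nat (2 * m - 2 * k + 2)))"
proof -
  have "\<exists>z. (\<lambda>n. 1 / real (Suc n) ^ s) sums z \<and> zeta (of_nat s) = of_real z" if "s \<ge> 2" for s
    using of_real_zeta_sums[OF that] by metis
  then obtain Z where Z: "\<And>s. s \<ge> 2 \<Longrightarrow> (\<lambda>n. 1 / real (Suc n) ^ s) sums Z s"
    and zeta: "\<And>s. s \<ge> 2 \<Longrightarrow> zeta (of_nat s) = of_real (Z s)"
    by metis
  have "\<exists>z. (\<lambda>n. odd_harm (Suc n) / real (Suc n) ^ s) sums z \<and> zeta_h (of_nat s) = of_real z"
    if "s \<ge> 2" for s
    using of_real_zeta_h_sums[OF that] by metis
  then obtain H where H: "\<And>s. s \<ge> 2 \<Longrightarrow> (\<lambda>n. odd_harm (Suc n) / real (Suc n) ^ s) sums H s"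
    and zeta_h: "\<And>s. s \<ge> 2 \<Longrightarrow> zeta_h (of_nat s) = of_real (H s)"
    by metis
  define S where "S = (\<Sum>k=1..m. H (2 * k) * ((2 ^ (2 * m - 2 * k + 2) - 1) * Z (2 * m - 2 * k + 2)))"
  have "S = pi ^ 2 / 8 * ((2 ^ (2 * m + 1) - 1) * Z (2 * m + 1))"
    unfolding S_def
    by (rule odd_harm_zeta_convolution[OF assms, of "\<lambda>s. (2 ^ s - 1) * Z s" H])
       (use H Z in \<open>auto intro: half_odd_power_sums simp del: of_nat_Suc\<close>)
  moreover have "(2::real) ^ (2 * m + 1) - 1 \<noteq> 0"
    using one_less_power[of "2::real" "2 * m + 1"] by simp
  ultimately have real: "Z (2 * m + 1) = 8 / pi ^ 2 * (1 / (2 ^ (2 * m + 1) - 1)) * S"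
    by (simp only:) (simp add: divide_simps)
  have "(\<Sum>k=1..m. zeta_h (of_nat (2 * k)) * (2 ^ (2 * m - 2 * k + 2) - 1)
       * zeta (of_nat (2 * m - 2 * k + 2))) = of_real S"
    unfolding S_def of_real_sum
  proof (rule sum.cong[OF refl])
    fix k assume "k \<in> {1..m}"
    hence "2 * k \<ge> 2" "2 * m - 2 * k + 2 \<ge> 2" by auto
    thus "zeta_h (of_nat (2 * k)) * (2 ^ (2 * m - 2 * k + 2) - 1)
        * zeta (of_nat (2 * m - 2 * k + 2))
      = of_real (H (2 * k) * ((2 ^ (2 * m - 2 * k + 2) - 1) * Z (2 * m - 2 * k + 2)))"
      by (simp only: zeta zeta_h) (simp add: mult.assoc)
  qed
  moreover have "zeta (of_nat (2 * m + 1)) = of_real (Z (2 * m + 1))"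
    using assms by (intro zeta) simp
  ultimately show ?thesis
    by (simp only: real) simp
qed

end
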